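(* Let $m\equiv 2\pmod 4$, $n=2m$, $\mathbb M=\mathbb F_{2^m}$. Let $q=2^k$ with $0<k<m$, $\gcd(k,m)=1$, $r=2^{k+m/2}$, let $a\in\mathbb F_{2^{m/2}}^\times$ and let $B\in\mathbb M^\times$ be a non-cube with $B^{q+r}\neq a^{q+1}$. Then the APN function $F$ on $\mathbb F_{2^n}\cong\mathbb M\times\mathbb M$ given by $$F(x,y)=\left(x^{q+1}+By^{q+1},\;x^ry+\tfrac{a}{B}xy^r\right)$$ (that is, every function in the family $\mathcal F_4$) is $3$-to-$1$ and has classical Walsh spectrum.
   Context: $\mathbb F_{2^n}$ is identified with $\mathbb M\times\mathbb M$ as an $\mathbb F_2$-vector space. A function $F$ on a finite $\mathbb F_2$-vector space is called $3$-to-$1$ here if $F(z)=0$ if and only if $z=0$, and every nonzero element of the image of $F$ has precisely $3$ preimages. For $F:\mathbb F_{2^n}\to\mathbb F_{2^n}$ and $a,b\in\mathbb F_{2^n}$ put $W_F(b,a)=\sum_{x\in\mathbb F_{2^n}}(-1)^{\mathrm{Tr}(bF(x)+ax)}\in\mathbb Z$, with $\mathrm{Tr}$ the absolute trace of $\mathbb F_{2^n}$. The extended Walsh spectrum of $F$ is the multiset $\{|W_F(b,a)|: b\in\mathbb F_{2^n}^\times,\,a\in\mathbb F_{2^n}\}$ (it does not depend on the chosen $\mathbb F_2$-linear identification). For even $n$, $F$ has classical Walsh spectrum if its extended Walsh spectrum contains the values $0$, $2^{n/2}$, $2^{(n+2)/2}$ precisely $(2^n-1)2^{n-2}$ times,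 $(2^n-1)2^{n+1}/3$ times, and $(2^n-1)2^{n-2}/3$ times, respectively. *)

theory Defs
  imports
    Complex_Main
    "HOL-Library.Cardinality"
    "HOL-Library.Multiset"
    "HOL-Library.Product_Plus"
    "HOL-Computational_Algebra.Primes"
begin

text \<open>The finite field of order \<open>2 ^ m\<close> is modelled by a type \<open>'m\<close> of class
  \<^class>\<open>finite_field\<close> with \<open>CARD('m) = 2 ^ m\<close>, so that its characteristic is 2.\<close>

definition three_to_one :: "('a::zero \<Rightarrow> 'a) \<Rightarrow> bool" where
  "three_to_one F \<longleftrightarrow>
     (\<forall>z. F z = 0 \<longleftrightarrow> z = 0) \<and>
     (\<forall>w \<in> range F. w \<noteq> 0 \<longrightarrow> card {z. F z = w} = 3)"

definition APN :: "('a::{ab_group_add,finite} \<Rightarrow> 'a) \<Rightarrow> bool" where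
  "APN F \<longleftrightarrow> (\<forall>d e. d \<noteq> 0 \<longrightarrow> card {x. F (x + d) - F x = e} \<le> 2)"

text \<open>The absolute trace of the field of order \<open>2 ^ n\<close>. Its values lie in the prime
  field, i.e. they are the field elements 0 and 1.\<close>

definition abs_trace :: "nat \<Rightarrow> 'k::finite_field \<Rightarrow> 'k" where
  "abs_trace n x = (\<Sum>i<n. x ^ (2 ^ i))"

text \<open>The integer \<open>(-1) ^ z\<close> for \<open>z\<close> in the prime field of characteristic 2.\<close>

definition sign_F2 :: "'k::finite_field \<Rightarrow> int" where
  "sign_F2 z = (if z = 0 then 1 else -1)"

definition walsh :: "nat \<Rightarrow> ('k::finite_field \<Rightarrow> 'k) \<Rightarrow> 'k \<Rightarrow> 'k \<Rightarrow> int" where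
  "walsh n F b a = (\<Sum>x\<in>UNIV. sign_F2 (abs_trace n (b * F x + a * x)))"

definition extended_walsh_spectrum :: "nat \<Rightarrow> ('k::finite_field \<Rightarrow> 'k) \<Rightarrow> int multiset" where
  "extended_walsh_spectrum n F =
     image_mset (\<lambda>(b, a). \<bar>walsh n F b a\<bar>) (mset_set ((UNIV - {0}) \<times> UNIV))"

text \<open>Meant for even \<open>n\<close> and a field of order \<open>2 ^ n\<close>.\<close>

definition classical_walsh_spectrum :: "nat \<Rightarrow> ('k::finite_field \<Rightarrow> 'k) \<Rightarrow> bool" where
  "classical_walsh_spectrum n F \<longleftrightarrow>
     real (count (extended_walsh_spectrum n F) 0) = (2 ^ n - 1) * 2 ^ (n - 2) \<and>
     real (count (extended_walsh_spectrum n F) (2 ^ (n div 2))) = (2 ^ n - 1) * 2 ^ (n + 1) / 3 \<and>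
     real (count (extended_walsh_spectrum n F) (2 ^ ((n + 2) div 2))) = (2 ^ n - 1) * 2 ^ (n - 2) / 3"

text \<open>The subfield of order \<open>2 ^ d\<close> of a field of order \<open>2 ^ m\<close>, for \<open>d dvd m\<close>, as the
  root set of \<open>X ^ (2 ^ d) - X\<close>.\<close>

definition subfield_GF2 :: "nat \<Rightarrow> 'm::finite_field set" where
  "subfield_GF2 d = {x. x ^ (2 ^ d) = x}"

definition F4 :: "nat \<Rightarrow> nat \<Rightarrow> 'm::finite_field \<Rightarrow> 'm \<Rightarrow> 'm \<times> 'm \<Rightarrow> 'm \<times> 'm" where
  "F4 q r a B = (\<lambda>(x, y). (x ^ (q + 1) + B * y ^ (q + 1), x ^ r * y + (a / B) * x * y ^ r))"

text \<open>An identification of the field \<open>'k\<close> with the plane over \<open>'m\<close> as vector spaces over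
  the field with two elements; over that prime field linearity is additivity.\<close>

definition F2_identification :: "('k::finite_field \<Rightarrow> 'm::finite_field \<times> 'm) \<Rightarrow> bool" where
  "F2_identification \<phi> \<longleftrightarrow> bij \<phi> \<and> additive \<phi>"

end

theory Submission
  imports Defs "HOL-Computational_Algebra.Polynomial"
begin

text \<open>APN: after scaling, a kernel vector of a derivative of \<open>F\<close> off the coordinate axes solves two
  equations over \<open>M\<close> whose coefficients are a non-cube \<open>\<beta>\<close> and an element \<open>\<kappa>\<close> of the index-2
  subfield \<open>K\<close>. Every element of \<open>K\<close> is a cube, and \<open>x \<mapsto> x ^ q\<close> as well as \<open>x \<mapsto> x ^ (2 ^ (m div 2))\<close>
  invert classes modulo cubes, so a nontrivial solution would make \<open>\<beta>\<close> a cube.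

  3-to-1: if \<open>w\<close> is a primitive cube root of unity, then \<open>F\<close> is invariant under
  \<open>(x, y) \<mapsto> (w * x, w ^ 2 * y)\<close>, and an APN function has no room for larger fibres.

  Walsh spectrum: by 3-to-1-ness \<open>W(b, 0)\<close> is 1 modulo 3, and the first two moments of \<open>W(b, 0)\<close> over
  \<open>b\<close> are known; since \<open>F\<close> is quadratic, \<open>W(b, 0)\<close> is \<open>2 ^ m\<close> times an integer. These facts force
  \<open>W(b, 0) / 2 ^ m\<close> to be 1 or -2 for \<open>b \<noteq> 0\<close>, and Parseval's identity gives the rest.\<close>

section \<open>Cubes\<close>

definition is_cube :: "'a::field \<Rightarrow> bool" where
  "is_cube x \<longleftrightarrow> (\<exists>c. x = c ^ 3)"

lemma is_cube_power3 [simp]: "is_cube (x ^ 3)"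
  by (auto simp: is_cube_def)

lemma is_cube_mult: "is_cube x \<Longrightarrow> is_cube y \<Longrightarrow> is_cube (x * y)"
  unfolding is_cube_def by (metis power_mult_distrib)

lemma is_cube_divide: "is_cube x \<Longrightarrow> is_cube y \<Longrightarrow> is_cube (x / y)"
  unfolding is_cube_def by (metis power_divide)

lemma is_cube_cancel: "is_cube (x * y) \<Longrightarrow> is_cube y \<Longrightarrow> y \<noteq> 0 \<Longrightarrow> is_cube x"
  using is_cube_divide[of "x * y" y] by simp

text \<open>A nonzero \<open>x\<close> is the quotient of the cubes \<open>x ^ 3\<close> and
  \<open>x ^ 2\<close>.\<close>

lemma is_cube_square: "is_cube (x ^ 2) \<Longrightarrow> is_cube x"
proof (cases "x = 0")
  case False
  assume "is_cube (x ^ 2)"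
  moreover have "x ^ 3 = x * x ^ 2"
    by (simp add: power2_eq_square power3_eq_cube)
  ultimately show ?thesis
    using is_cube_cancel[of x "x ^ 2"] is_cube_power3[of x] False by simp
qed (simp add: is_cube_def exI[of _ 0])

section \<open>Kernels of the derivatives\<close>

text \<open>\<open>f\<close> and \<open>g\<close> stand for \<open>x \<mapsto> x ^ (2 ^ k)\<close> and \<open>x \<mapsto> x ^ (2 ^ (m div 2))\<close>. Both exponents of 2
  are odd, so both maps invert classes modulo cubes; this is what the last two assumptions say.\<close>

locale frobenius_pair =
  fixes f g :: "'a::finite_field \<Rightarrow> 'a"
  assumes char_two: "CHAR('a) = 2"
    and f_add: "f (x + y) = f x + f y" and f_mult: "f (x * y) = f x * f y" and f_one: "f 1 = 1"
    and g_add: "g (x + y) = g x + g y" and g_mult: "g (x * y) = g x * g y" and g_one: "g 1 = 1"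
    and f_fixed: "f x = x \<Longrightarrow> x = 0 \<or> x = 1"
    and g_g: "g (g x) = x" and f_g: "f (g x) = g (f x)"
    and is_cube_g_fixed: "g x = x \<Longrightarrow> is_cube x"
    and is_cube_mult_f: "is_cube (x * f x)" and is_cube_mult_g: "is_cube (x * g x)"
begin

lemma one_add_one: "(1::'a) + 1 = 0"
  using of_nat_CHAR[where 'a='a] char_two by simp

lemma add_self: "x + x = (0::'a)"
  by (metis distrib_left mult.right_neutral mult_zero_right one_add_one)

lemma add_eq_0_iff_eq: "x + y = 0 \<longleftrightarrow> x = (y::'a)"
  by (metis add_self add_right_cancel)

lemma add_self_left: "x + (x + y) = (y::'a)"
  by (simp add: add_self flip: add.assoc)

lemmas char_two_simps = algebra_simps power2_eq_square add_self add_self_left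

lemma f_zero: "f 0 = 0" and g_zero: "g 0 = 0"
  by (metis f_add add_0_right add_left_cancel) (metis g_add add_0_right add_left_cancel)

lemma f_eq_0_iff: "f x = 0 \<longleftrightarrow> x = 0"
  by (metis f_mult f_one f_zero left_inverse mult_zero_right zero_neq_one)

lemma g_eq_0_iff: "g x = 0 \<longleftrightarrow> x = 0"
  by (metis g_g g_zero)

lemma f_inverse: "f (inverse x) = inverse (f x)"
  by (metis f_eq_0_iff f_mult f_one left_inverse inverse_unique inverse_zero mult.commute)

lemma g_inverse: "g (inverse x) = inverse (g x)"
  by (metis g_eq_0_iff g_mult g_one left_inverse inverse_unique inverse_zero mult.commute)

lemma f_divide: "f (x / y) = f x / f y" and g_divide: "g (x / y) = g x / g y"
  by (simp_all add: divide_inverse f_mult f_inverse g_mult g_inverse)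

text \<open>Multiplying the relation by \<open>v\<close> completes \<open>g v\<close> and
  \<open>f v\<close> to the cubes \<open>v * g v\<close> and \<open>v * f v\<close>, leaving
  \<open>b\<close> as a quotient of cubes.\<close>

lemma is_cube_twist:
  assumes "is_cube c" and "c \<noteq> 0" and "is_cube d" and "v \<noteq> 0" and "b * g v * c = d * f v"
  shows "is_cube b"
proof -
  have "b * ((v * g v) * c) = d * (v * f v)"
    using arg_cong[OF assms(5), of "(*) v"] by (simp add: mult_ac)
  moreover have "is_cube (d * (v * f v))"
    using assms by (intro is_cube_mult is_cube_mult_f)
  ultimately have "is_cube (b * ((v * g v) * c))"
    by (simp only:)
  then show ?thesis
    by (rule is_cube_cancel) (use assms in \<open>auto intro!: is_cube_mult is_cube_mult_g simp: g_eq_0_iff\<close>)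
qed

text \<open>\<open>A\<close> and \<open>g A\<close> satisfy a linear system over the fixed field of \<open>g\<close> with determinant \<open>\<kappa>\<^sup>2 + N\<close>. If it is
  invertible, then comparing \<open>A\<close> with \<open>f A + A\<close> relates \<open>f V\<close> to \<open>\<beta> * g V\<close> by a factor fixed by \<open>g\<close>,
  hence by a cube; otherwise \<open>T\<close>, and then \<open>\<beta>\<close>, is a cube. The hypothesis \<open>norm\<close> rules out
  \<open>\<kappa> = N = 1\<close>.\<close>

lemma normalised_kernel_generic:
  assumes \<beta>: "\<not> is_cube \<beta>" and \<kappa>: "g \<kappa> = \<kappa>" "\<kappa> \<noteq> 0"
    and norm: "f (\<beta> * g \<beta>) \<noteq> f \<kappa> * \<kappa>"
    and eq1: "f s + s = \<beta> * (f t + t)"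
    and eq2: "\<beta> * (f (g s) + t) = \<kappa> * (s + f (g t))"
  shows "f t = t"
proof (rule ccontr)
  assume t: "f t \<noteq> t"
  define T where "T = f t + t"
  \<comment> \<open>Up to multiples of \<open>g T\<close>, \<open>f (g s)\<close> is
    \<open>g s\<close> and \<open>f (g t)\<close> is \<open>g t\<close>, so \<open>eq2\<close>
    becomes linear in \<open>A\<close> and \<open>g A\<close>; this is \<open>E1\<close>, and
    \<open>E2\<close> is its image under \<open>g\<close>.\<close>
  define A where "A = s + g t"
  define N where "N = \<beta> * g \<beta>"
  define V where "V = \<kappa> * g T + \<beta> * T"
  have T0: "T \<noteq> 0" using t by (simp add: T_def add_eq_0_iff_eq)
  then have gT0: "g T \<noteq> 0" by (simp add: g_eq_0_iff)
  have gN: "g N = N" by (simp add: N_def g_mult g_g mult.commute)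
  have gA: "g A = g s + t" by (simp add: A_def g_add g_g)
  have gT: "g T = f (g t) + g t" by (simp add: T_def g_add f_g)
  have gS: "f (g s) + g s = g \<beta> * g T"
    using arg_cong[OF eq1, of g] by (simp add: g_add g_mult f_g gT)
  have fA: "f A + A = \<beta> * T + g T"
    unfolding A_def gT using eq1 by (simp add: f_add T_def algebra_simps)
  have E1: "\<beta> * g A + \<kappa> * A = (\<kappa> + N) * g T"
  proof -
    have "\<beta> * g A + \<kappa> * A + (\<kappa> + N) * g T
        = (\<beta> * (f (g s) + t) + \<kappa> * (s + f (g t))) + \<beta> * ((f (g s) + g s) + g \<beta> * g T)"
      unfolding gA N_def gT unfolding A_def by (simp add: char_two_simps)
    also have "\<dots> = 0"
      unfolding gS eq2 by (simp add: add_self)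
    finally show ?thesis by (simp add: add_eq_0_iff_eq)
  qed
  have E2: "g \<beta> * A + \<kappa> * g A = (\<kappa> + N) * T"
    using arg_cong[OF E1, of g] by (simp add: g_add g_mult g_g \<kappa> gN)
  \<comment> \<open>Cramer's rule: \<kappa> times \<open>E1\<close> plus \<beta> times
    \<open>E2\<close> eliminates \<open>g A\<close>.\<close>
  have E3: "(\<kappa>^2 + N) * A = (\<kappa> + N) * V"
  proof -
    have "(\<kappa>^2 + N) * A = \<kappa> * (\<beta> * g A + \<kappa> * A) + \<beta> * (g \<beta> * A + \<kappa> * g A)"
      unfolding N_def by (simp add: char_two_simps)
    also have "\<dots> = (\<kappa> + N) * V"
      unfolding E1 E2 V_def by (simp add: algebra_simps)
    finally show ?thesis .
  qed
  have gV: "\<beta> * g V = \<kappa> * \<beta> * T + N * g T"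
    by (simp add: V_def g_add g_mult g_g \<kappa> N_def algebra_simps)
  show False
  proof (cases "\<kappa>^2 + N = 0")
    case True
    then have N: "N = \<kappa>^2" by (simp add: add_eq_0_iff_eq)
    have \<kappa>1: "\<kappa> \<noteq> 1" using norm N by (auto simp: N_def f_one)
    then have "\<kappa> + N \<noteq> 0"
      using N \<kappa> by (simp add: add_eq_0_iff_eq power2_eq_square)
    then have "V = 0" using E3 True by simp
    then have \<beta>T: "\<kappa> * g T = \<beta> * T" by (simp add: V_def add_eq_0_iff_eq)
    \<comment> \<open>In terms of \<open>z\<close>, \<open>E1\<close> reads
      \<open>g z + z = 1 + \<kappa>\<close>, and \<open>fA\<close> turns into
      \<open>f z * f (g T) = g z * g T\<close>, a product relation that can be read modulo
      cubes.\<close>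
    define z where "z = A / g T"
    have A: "A = z * g T" using gT0 by (simp add: z_def)
    have gA': "g A = g z * T" by (simp add: A g_mult g_g)
    have "\<kappa> * g T * (g z + z) = g z * (\<beta> * T) + \<kappa> * (z * g T)"
      unfolding \<beta>T[symmetric] by (simp add: algebra_simps)
    also have "\<dots> = \<kappa> * g T * (1 + \<kappa>)"
      using E1 unfolding gA' N unfolding A by (simp add: algebra_simps power2_eq_square)
    finally have "\<kappa> * g T * (g z + z) = \<kappa> * g T * (1 + \<kappa>)" .
    then have z: "g z + z = 1 + \<kappa>" using \<kappa> gT0 by simp
    have z0: "z \<noteq> 0" using z \<kappa>1 by (auto simp: g_zero add_eq_0_iff_eq dest: sym)
    have "f z * f (g T) + z * g T = (1 + \<kappa>) * g T"
      using fA \<beta>T unfolding A by (simp add: f_mult algebra_simps)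
    then have "f z * f (g T) = g z * g T"
      unfolding z[symmetric] by (simp add: algebra_simps)
    from arg_cong[OF this, of g] have H: "f (g z) * f T = z * T"
      by (simp add: g_mult g_g flip: f_g)
    \<comment> \<open>The factor \<open>T * f z\<close> completes everything except
      \<open>T ^ 2\<close> to products \<open>u * f u\<close> or \<open>u * g u\<close>.\<close>
    have "T ^ 2 * (z * f z) = (T * f T) * (f z * g (f z))"
      using arg_cong[OF H[symmetric], of "\<lambda>u. T * f z * u"] by (simp add: f_g mult_ac power2_eq_square)
    moreover have "is_cube ((T * f T) * (f z * g (f z)))"
      by (intro is_cube_mult is_cube_mult_f is_cube_mult_g)
    ultimately have "is_cube (T ^ 2 * (z * f z))"
      by (simp only:)
    then have "is_cube (T ^ 2)"
      by (rule is_cube_cancel) (use z0 in \<open>simp_all add: is_cube_mult_f f_eq_0_iff\<close>)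
    moreover have "\<beta> * T ^ 2 = \<kappa> * (T * g T)"
      using arg_cong[OF \<beta>T[symmetric], of "(*) T"] by (simp add: mult_ac power2_eq_square)
    moreover have "is_cube (\<kappa> * (T * g T))"
      using \<kappa> by (intro is_cube_mult is_cube_g_fixed is_cube_mult_g) auto
    ultimately show False
      using is_cube_cancel[of \<beta> "T ^ 2"] T0 \<beta> by simp
  next
    case \<mu>: False
    have "V \<noteq> 0"
    proof
      assume "V = 0"
      then have "\<kappa> * g T = \<beta> * T" by (simp add: V_def add_eq_0_iff_eq)
      moreover from arg_cong[OF this, of g] have "\<kappa> * T = g \<beta> * g T"
        by (simp add: g_mult g_g \<kappa>)
      ultimately have "\<kappa> ^ 2 * g T = N * g T"
        unfolding N_def power2_eq_square by (metis mult.assoc mult.left_commute)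
      with \<mu> gT0 show False by (simp add: add_eq_0_iff_eq)
    qed
    have \<kappa>1: "\<kappa> \<noteq> 1"
    proof
      assume "\<kappa> = 1"
      \<comment> \<open>For \<open>\<kappa> = 1\<close> both factors in \<open>E3\<close> are
        \<open>1 + N\<close>, and \<open>V\<close> is also the right side of
        \<open>fA\<close>.\<close>
      then have "A = V" and "f A + A = V"
        using E3 \<mu> fA by (simp_all add: V_def add.commute)
      then have "f V = 0" by simp
      with \<open>V \<noteq> 0\<close> show False by (simp add: f_eq_0_iff)
    qed
    have \<lambda>: "\<kappa> + N \<noteq> 0"
    proof
      assume *: "\<kappa> + N = 0"
      then have "A = 0" using E3 \<mu> by simp
      then have \<beta>T: "\<beta> * T = g T" using fA by (simp add: f_zero add_eq_0_iff_eq)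
      moreover from arg_cong[OF this, of g] have "g \<beta> * g T = T" by (simp add: g_mult g_g)
      ultimately have "N * g T = 1 * g T" by (simp add: N_def mult.assoc)
      with gT0 have "N = 1" by simp
      with * \<kappa>1 show False by (simp add: add_eq_0_iff_eq)
    qed
    define \<theta> where "\<theta> = (\<kappa> + N) / (\<kappa>^2 + N)"
    have A: "A = \<theta> * V" using E3 \<mu> by (simp add: \<theta>_def field_simps)
    have \<theta>: "\<theta> * (\<kappa>^2 + N) = \<kappa> + N" using \<mu> by (simp add: \<theta>_def)
    have "f \<theta> * f V = \<theta> * V + (\<beta> * T + g T)"
      using fA unfolding A f_mult by (metis add.commute add_self_left)
    then have "(\<kappa>^2 + N) * (f \<theta> * f V) = (\<theta> * (\<kappa>^2 + N)) * V + (\<kappa>^2 + N) * (\<beta> * T + g T)"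
      by (simp add: algebra_simps)
    \<comment> \<open>In characteristic 2 the coefficients of \<open>\<beta> * T\<close> and
      \<open>g T\<close> collapse to \<open>\<kappa> * (1 + \<kappa>)\<close> and
      \<open>N * (1 + \<kappa>)\<close>, matching \<open>gV\<close>.\<close>
    also have "\<dots> = (1 + \<kappa>) * (\<beta> * g V)"
      unfolding \<theta> gV unfolding V_def by (simp add: char_two_simps)
    finally have "(\<kappa>^2 + N) * (f \<theta> * f V) = (1 + \<kappa>) * (\<beta> * g V)" .
    then have eq: "\<beta> * g V * (1 + \<kappa>) = (f \<theta> * (\<kappa>^2 + N)) * f V"
      by (simp add: mult_ac)
    have "g \<theta> = \<theta>"
      by (simp add: \<theta>_def g_divide g_add g_mult gN \<kappa> power2_eq_square)
    then have "is_cube (f \<theta> * (\<kappa>^2 + N))" and "is_cube (1 + \<kappa>)"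
      by (auto intro!: is_cube_g_fixed simp: g_mult g_add power2_eq_square \<kappa> gN g_one simp flip: f_g)
    moreover have "1 + \<kappa> \<noteq> 0"
      using \<kappa>1 by (auto simp: add_eq_0_iff_eq)
    ultimately have "is_cube \<beta>"
      using is_cube_twist eq \<open>V \<noteq> 0\<close> by blast
    with \<beta> show False by simp
  qed
qed

text \<open>With \<open>t\<close> also \<open>s\<close> is fixed by \<open>f\<close>, so both are 0
  or 1. A mixed pair would turn \<open>eq2\<close> into \<open>\<beta> = \<kappa>\<close>, but
  \<kappa> is a cube.\<close>

lemma normalised_kernel:
  assumes \<beta>: "\<not> is_cube \<beta>" and \<kappa>: "g \<kappa> = \<kappa>" "\<kappa> \<noteq> 0"
    and norm: "f (\<beta> * g \<beta>) \<noteq> f \<kappa> * \<kappa>"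
    and eq1: "f s + s = \<beta> * (f t + t)"
    and eq2: "\<beta> * (f (g s) + t) = \<kappa> * (s + f (g t))"
  shows "s = t \<and> (t = 0 \<or> t = 1)"
proof -
  have t: "f t = t"
    using assms by (rule normalised_kernel_generic)
  then have s: "f s = s"
    using eq1 by (simp add: add_self add_eq_0_iff_eq)
  have "\<beta> \<noteq> \<kappa>"
    using \<beta> \<kappa> is_cube_g_fixed by auto
  then show ?thesis
    using f_fixed[OF s] f_fixed[OF t] eq2 by (auto simp: f_zero g_zero f_one g_one)
qed

text \<open>Two inversions of classes modulo cubes cancel: the ratio is \<open>f x * g (f x)\<close>
  over \<open>x * f x\<close>.\<close>

lemma is_cube_ratio: "x \<noteq> 0 \<Longrightarrow> is_cube (f (g x) / x)"
  using is_cube_divide[OF is_cube_mult_g[of "f x"] is_cube_mult_f[of x]]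
  by (simp add: f_g f_eq_0_iff)

text \<open>The relation says that \<open>f\<close> fixes \<open>x / u\<close>.\<close>

lemma eq_of_ratio:
  assumes "f x * u = x * f u" and "u \<noteq> 0"
  shows "x = 0 \<or> x = u"
  using f_fixed[of "x / u"] assms by (auto simp: f_divide f_eq_0_iff field_simps)

text \<open>Otherwise the equation writes \<open>B\<close> as a product and quotient of cubes:
  \<open>a\<close> and two ratios as in \<open>is_cube_ratio\<close>.\<close>

lemma axis_kernel:
  assumes B: "\<not> is_cube B" and a: "g a = a"
    and eq: "f (g u) * y = a / B * (u * f (g y))" and u: "u \<noteq> 0"
  shows "y = 0"
proof (rule ccontr)
  assume y: "y \<noteq> 0"
  have "B \<noteq> 0" using B by (auto simp: is_cube_def exI[of _ 0])
  then have "B = a * (f (g y) / y) / (f (g u) / u)"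
    using eq u y by (simp add: field_simps f_eq_0_iff g_eq_0_iff)
  moreover have "is_cube \<dots>"
    using a u y by (intro is_cube_divide is_cube_mult is_cube_ratio is_cube_g_fixed)
  ultimately show False using B by simp
qed

text \<open>The two equations say that the polar form of \<open>biprojective B (a / B)\<close>
  vanishes at \<open>(x, y)\<close> and \<open>(u, v)\<close>. Directions on an axis are separate
  because the scaling divides by both \<open>u\<close> and \<open>v\<close>.\<close>

lemma kernel:
  assumes B: "\<not> is_cube B" and a: "g a = a" "a \<noteq> 0"
    and norm: "f (B * g B) \<noteq> f a * a"
    and eq1: "f x * u + x * f u + B * (f y * v + y * f v) = 0"
    and eq2: "f (g x) * v + f (g u) * y + a / B * (x * f (g v) + u * f (g y)) = 0"
    and uv: "u \<noteq> 0 \<or> v \<noteq> 0"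
  shows "x = 0 \<and> y = 0 \<or> x = u \<and> y = v"
proof -
  have B0: "B \<noteq> 0" using B by (auto simp: is_cube_def exI[of _ 0])
  consider "v = 0" "u \<noteq> 0" | "u = 0" "v \<noteq> 0" | "u \<noteq> 0" "v \<noteq> 0" using uv by auto
  then show ?thesis
  proof cases
    case 1
    then have "f (g u) * y = a / B * (u * f (g y))"
      using eq2 by (simp add: f_zero g_zero add_eq_0_iff_eq)
    with 1 have "y = 0" by (intro axis_kernel[OF B a(1)])
    moreover have "x = 0 \<or> x = u"
      using eq1 1 \<open>y = 0\<close> by (intro eq_of_ratio) (simp_all add: f_zero add_eq_0_iff_eq)
    ultimately show ?thesis using 1 by auto
  next
    case 2
    then have "f (g x) * v = a / B * (x * f (g v))"
      using eq2 by (simp add: f_zero g_zero add_eq_0_iff_eq)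
    with 2 have "x = 0" using axis_kernel[OF B a(1)] by blast
    moreover have "y = 0 \<or> y = v"
      using eq1 2 B0 \<open>x = 0\<close> by (intro eq_of_ratio) (simp_all add: f_zero add_eq_0_iff_eq)
    ultimately show ?thesis using 2 by auto
  next
    case 3
    \<comment> \<open>After this scaling the direction is \<open>(1, 1)\<close>, and
      \<open>u\<close>, \<open>v\<close> survive only through \<open>w\<close>.\<close>
    define s t w where "s = x / u" and "t = y / v" and "w = u / v"
    define \<beta> \<kappa> where "\<beta> = B / (w * f w)" and "\<kappa> = a / f (w * g w)"
    have w: "w \<noteq> 0" using 3 by (simp add: w_def)
    note nz = 3 w B0 f_eq_0_iff g_eq_0_iff
    have "s = t \<and> (t = 0 \<or> t = 1)"
    proof (rule normalised_kernel)
      show "\<not> is_cube \<beta>"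
        using B is_cube_mult[OF _ is_cube_mult_f[of w], of \<beta>] nz by (auto simp: \<beta>_def)
      show "g \<kappa> = \<kappa>"
        by (simp add: \<kappa>_def g_divide f_mult g_mult a mult.commute g_g flip: f_g)
      show "\<kappa> \<noteq> 0" using a nz by (simp add: \<kappa>_def f_mult)
      \<comment> \<open>The denominators coming from \<open>w\<close> agree on both sides, so this
        is \<open>norm\<close> again.\<close>
      show "f (\<beta> * g \<beta>) \<noteq> f \<kappa> * \<kappa>"
        using norm nz by (simp add: \<beta>_def \<kappa>_def f_divide g_divide f_mult g_mult f_g mult_ac)
      show "f s + s = \<beta> * (f t + t)"
      proof -
        have "f x * u + x * f u = B * (f y * v + y * f v)"
          using eq1 by (simp add: add_eq_0_iff_eq)
        then show ?thesis
          using nz by (simp add: s_def t_def w_def \<beta>_def f_divide field_simps)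
      qed
      show "\<beta> * (f (g s) + t) = \<kappa> * (s + f (g t))"
      proof -
        have "B * (f (g x) * v + f (g u) * y) = a * (x * f (g v) + u * f (g y))"
          using eq2 B0 by (simp add: add_eq_0_iff_eq)
        moreover have "\<beta> * (f (g s) + t) = B * (f (g x) * v + f (g u) * y) / (f w * u * f (g u))"
          using nz by (simp add: s_def t_def w_def \<beta>_def f_divide g_divide field_simps)
        moreover have "\<kappa> * (s + f (g t)) = a * (x * f (g v) + u * f (g y)) / (f w * u * f (g u))"
          using nz by (simp add: s_def t_def w_def \<kappa>_def f_divide g_divide f_mult field_simps)
        ultimately show ?thesis
          by (simp only:)
      qed
    qed
    with 3 show ?thesis by (auto simp: s_def t_def)
  qed
qed

end

section \<open>Quadratic APN functions with a symmetry of order three\<close>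

definition polar :: "('a::ab_group_add \<Rightarrow> 'b::ab_group_add) \<Rightarrow> 'a \<Rightarrow> 'a \<Rightarrow> 'b" where
  "polar F x y = F (x + y) - F x - F y"

text \<open>The polar form is symmetric, so additivity in one argument means biadditivity.\<close>

definition quadratic :: "('a::ab_group_add \<Rightarrow> 'b::ab_group_add) \<Rightarrow> bool" where
  "quadratic F \<longleftrightarrow> (\<forall>y. additive (\<lambda>x. polar F x y))"

text \<open>Two solutions of one derivative equation differ by an element of the kernel of
  \<open>\<lambda>x. polar F x d\<close>, hence by 0 or \<open>d\<close>.\<close>

lemma APN_of_quadratic:
  fixes F :: "'a::{ab_group_add,finite} \<Rightarrow> 'a"
  assumes "quadratic F" and ker: "\<And>x y. polar F x y = 0 \<Longrightarrow> y \<noteq> 0 \<Longrightarrow> x = 0 \<or> x = y"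
  shows "APN F"
  unfolding APN_def
proof (intro allI impI)
  fix d e :: 'a
  assume d: "d \<noteq> 0"
  show "card {x. F (x + d) - F x = e} \<le> 2"
  proof (cases "{x. F (x + d) - F x = e} = {}")
    case False
    then obtain x0 where x0: "F (x0 + d) - F x0 = e" by auto
    have "x \<in> {x0, d + x0}" if "F (x + d) - F x = e" for x
    proof -
      have "polar F (x - x0) d = polar F x d - polar F x0 d"
        using assms(1) unfolding quadratic_def by (intro additive.diff) auto
      also have "\<dots> = 0"
        using that x0 by (simp add: polar_def)
      finally show ?thesis
        using ker[of "x - x0" d] d by (auto simp: algebra_simps)
    qed
    then have "{x. F (x + d) - F x = e} \<subseteq> {x0, d + x0}" by auto
    then have "card {x. F (x + d) - F x = e} \<le> card {x0, d + x0}"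
      by (intro card_mono) auto
    also have "\<dots> \<le> 2"
      by (simp add: card_insert_if)
    finally show ?thesis .
  qed simp
qed

text \<open>Double count the pairs \<open>(z, d)\<close> with \<open>d \<noteq> 0\<close> and \<open>F (z + d) = F z\<close>: each \<open>d\<close> admits at most two \<open>z\<close>,
  and each \<open>z \<noteq> 0\<close> has at least the two \<open>d\<close> leading to its orbit under \<open>\<rho>\<close>, so both bounds are sharp.\<close>

lemma three_to_one_of_APN:
  fixes F :: "'a::{ab_group_add,finite} \<Rightarrow> 'a"
  assumes "APN F" and "F 0 = 0" and inv: "\<And>z. F (\<rho> z) = F z"
    and \<rho>: "\<And>z. z \<noteq> 0 \<Longrightarrow> \<rho> z \<noteq> z" "\<And>z. z \<noteq> 0 \<Longrightarrow> \<rho> (\<rho> z) \<noteq> z" "\<And>z. z \<noteq> 0 \<Longrightarrow> \<rho> (\<rho> z) \<noteq> \<rho> z"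
  shows "three_to_one F"
proof -
  define E where "E z = {d \<in> UNIV - {0}. F (z + d) = F z}" for z
  \<comment> \<open>The values of \<open>b\<close> add up to exactly the APN bound summed over
    \<open>d\<close>.\<close>
  define b where "b z = (if z = 0 then 0 else 2 :: nat)" for z :: 'a
  have b_le: "b z \<le> card (E z)" for z
  proof (cases "z = 0")
    case False
    have "{\<rho> z - z, \<rho> (\<rho> z) - z} \<subseteq> E z"
      using \<rho>[OF False] by (auto simp: E_def inv)
    then have "card {\<rho> z - z, \<rho> (\<rho> z) - z} \<le> card (E z)"
      by (intro card_mono) auto
    then show ?thesis
      using \<rho>(3)[OF False] False by (auto simp: b_def card_insert_if)
  qed (simp add: b_def)
  have "(\<Sum>z\<in>UNIV. card (E z)) = (\<Sum>d\<in>UNIV - {0}. card {z \<in> UNIV. F (z + d) = F z})"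
    unfolding E_def by (rule sum_multicount_gen) auto
  also have "\<dots> \<le> (\<Sum>d\<in>UNIV - {0::'a}. 2)"
  proof (rule sum_mono)
    fix d :: 'a
    assume "d \<in> UNIV - {0}"
    moreover have "{z \<in> UNIV. F (z + d) = F z} = {z. F (z + d) - F z = 0}" by simp
    ultimately show "card {z \<in> UNIV. F (z + d) = F z} \<le> 2"
      using assms(1) unfolding APN_def by (metis DiffD2 singletonI)
  qed
  also have "\<dots> = (\<Sum>z\<in>UNIV. b z)"
    using sum.remove[of UNIV 0 b] by (simp add: b_def)
  finally have "(\<Sum>z\<in>UNIV. b z) = (\<Sum>z\<in>UNIV. card (E z))"
    using sum_mono[of UNIV b "\<lambda>z. card (E z)"] b_le by simp
  then have card_E: "card (E z) = b z" for z
    using sum_mono_inv[of b UNIV "\<lambda>z. card (E z)" z] b_le by simp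
  \<comment> \<open>Since \<open>b 0 = 0\<close>, the set \<open>E 0\<close> is empty, so no other
    point shares the value at 0.\<close>
  have "F z = 0 \<longleftrightarrow> z = 0" for z
    using card_E[of 0] assms(2) by (auto simp: b_def E_def)
  moreover have "card {z'. F z' = F z} = 3" if "F z \<noteq> 0" for z
  proof -
    have "{z'. F z' = F z} = insert z ((+) z ` E z)"
    proof (intro equalityI subsetI)
      fix z' assume "z' \<in> {z'. F z' = F z}"
      then have "z' = z \<or> z' - z \<in> E z" by (auto simp: E_def)
      then show "z' \<in> insert z ((+) z ` E z)" by force
    qed (auto simp: E_def)
    moreover have "z \<notin> (+) z ` E z" by (auto simp: E_def)
    ultimately show ?thesis
      using card_E[of z] that assms(2) by (auto simp: b_def card_image)
  qed
  ultimately show ?thesis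
    by (auto simp: three_to_one_def)
qed

section \<open>The biprojective form of the family\<close>

context frobenius_pair
begin

text \<open>This is \<open>F4\<close> with \<open>x ^ q\<close> abstracted to \<open>f x\<close>,
  \<open>x ^ r\<close> to \<open>f (g x)\<close> and \<open>a / B\<close> to
  \<open>c\<close>.\<close>

definition biprojective :: "'a \<Rightarrow> 'a \<Rightarrow> 'a \<times> 'a \<Rightarrow> 'a \<times> 'a" where
  "biprojective b c = (\<lambda>(x, y). (x * f x + b * (y * f y), f (g x) * y + c * x * f (g y)))"

lemma polar_biprojective:
  "polar (biprojective b c) (x, y) (u, v) =
    (f x * u + x * f u + b * (f y * v + y * f v),
     f (g x) * v + f (g u) * y + c * (x * f (g v) + u * f (g y)))"
  by (simp add: polar_def biprojective_def f_add g_add) (simp add: algebra_simps)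

lemma quadratic_biprojective: "quadratic (biprojective b c)"
  unfolding quadratic_def
  by (clarsimp simp: additive_def polar_biprojective f_add g_add) (simp add: algebra_simps)

context
  fixes a B
  assumes B: "\<not> is_cube B" and a: "g a = a" "a \<noteq> 0"
    and norm: "f (B * g B) \<noteq> f a * a"
begin

lemma APN_biprojective: "APN (biprojective B (a / B))"
proof (rule APN_of_quadratic[OF quadratic_biprojective])
  fix z d :: "'a \<times> 'a"
  assume "polar (biprojective B (a / B)) z d = 0" and "d \<noteq> 0"
  then show "z = 0 \<or> z = d"
    using kernel[OF B a norm, of "fst z" "fst d" "snd z" "snd d"]
      polar_biprojective[of B "a / B" "fst z" "snd z" "fst d" "snd d"]
    by (cases z; cases d) (auto simp: zero_prod_def)
qed

text \<open>Every monomial is multiplied by a power of \<open>w ^ 3\<close>, because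
  \<open>f w = w ^ 2\<close> and \<open>f (g w) = w\<close>; the symmetry fixes only 0, as neither
  \<open>w\<close> nor \<open>w ^ 2\<close> is 1.\<close>

lemma three_to_one_biprojective:
  assumes w: "w ^ 3 = 1" "w \<noteq> 1" and fg: "f w = w ^ 2" "g w = w ^ 2"
  shows "three_to_one (biprojective B (a / B))"
proof (rule three_to_one_of_APN[OF APN_biprojective])
  define \<rho> :: "'a \<times> 'a \<Rightarrow> 'a \<times> 'a" where "\<rho> = (\<lambda>(x, y). (w * x, w ^ 2 * y))"
  have w0: "w \<noteq> 0" using w by auto
  have w3: "w * (w * w) = 1" "w * (w * (w * x)) = x" for x
  proof -
    show *: "w * (w * w) = 1" using w(1) by (simp add: power3_eq_cube mult.assoc)
    have "w * (w * (w * x)) = (w * (w * w)) * x" by (simp only: mult.assoc)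
    then show "w * (w * (w * x)) = x" by (simp only: * mult_1_left)
  qed
  have w2: "w * w \<noteq> 1" using w3(1) w(2) by auto
  have fixpt: "w * x = x \<longleftrightarrow> x = 0" "w * (w * x) = x \<longleftrightarrow> x = 0" for x
    using w(2) w2 mult_cancel_right1[of "w * w" x] by (simp_all add: mult.assoc)
  show "biprojective B (a / B) 0 = 0"
    by (simp add: biprojective_def zero_prod_def f_zero g_zero)
  show "biprojective B (a / B) (\<rho> z) = biprojective B (a / B) z" for z
    by (cases z) (simp add: biprojective_def \<rho>_def f_mult g_mult fg power2_eq_square mult_ac w3)
  have \<rho>: "\<rho> z = z \<longleftrightarrow> z = 0" "\<rho> (\<rho> z) = z \<longleftrightarrow> z = 0" "\<rho> z = 0 \<longleftrightarrow> z = 0" for z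
    using w0 w(2) by (simp_all add: \<rho>_def zero_prod_def power2_eq_square mult.assoc w3 fixpt split: prod.splits)
  then show "\<rho> z \<noteq> z" "\<rho> (\<rho> z) \<noteq> z" "\<rho> (\<rho> z) \<noteq> \<rho> z" if "z \<noteq> 0" for z
    using that by blast+
qed

end
end

section \<open>Frobenius powers\<close>

lemma CHAR_eq_2_of_CARD:
  assumes "CARD('a::finite_field) = 2 ^ m" and "0 < m"
  shows "CHAR('a) = 2"
proof -
  have "(- 1 :: 'a) = (- 1) ^ 2 ^ m"
    using finite_field_power_card_eq_same[of "- 1 :: 'a"] assms(1) by simp
  also have "\<dots> = 1"
    using assms(2) by (simp add: minus_one_power_iff)
  finally have "of_nat 2 = (0 :: 'a)"
    by (metis add.right_inverse of_nat_1 of_nat_add one_add_one)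
  then have "CHAR('a) dvd 2"
    by (simp only: of_nat_eq_0_iff_char_dvd)
  then show ?thesis
    using primes_dvd_imp_eq[OF CHAR_prime two_is_prime_nat] by blast
qed

text \<open>Modulo 3 the number 2 is -1. This is what makes \<open>x * x ^ (2 ^ k)\<close> a cube
  for odd \<open>k\<close>.\<close>

lemma three_dvd_two_power_Suc: "odd k \<Longrightarrow> 3 dvd (2 ^ k + 1 :: nat)"
proof (elim oddE)
  fix j assume "k = 2 * j + 1"
  moreover have "2 ^ (2 * j + 1) mod 3 = (2 :: nat)"
  proof (induction j)
    case (Suc j)
    have "2 ^ (2 * Suc j + 1) = 4 * (2 ^ (2 * j + 1) :: nat)"
      by (simp add: eval_nat_numeral)
    with Suc show ?case by presburger
  qed simp
  ultimately show ?thesis by presburger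
qed

lemma power_two_power_mult_fixed: "x ^ (2 ^ k) = x \<Longrightarrow> (x::'a::comm_monoid_mult) ^ (2 ^ (k * j)) = x"
proof (induction j)
  case (Suc j)
  have "x ^ 2 ^ (k * Suc j) = x ^ (2 ^ k * 2 ^ (k * j))"
    by (simp add: power_add)
  also have "\<dots> = x"
    using Suc by (simp only: power_mult[of x "2 ^ k"])
  finally show ?case .
qed simp

lemma frobenius_pair_power:
  assumes card: "CARD('a::finite_field) = 2 ^ (2 * h)" and h: "odd h"
    and k: "coprime k (2 * h)"
  shows "frobenius_pair (\<lambda>x::'a. x ^ (2 ^ k)) (\<lambda>x. x ^ (2 ^ h))"
proof
  have "h > 0" using h by (cases h) auto
  have "odd k" using k by auto
  have card': "x ^ (2 ^ (2 * h)) = x" for x :: 'a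
    using finite_field_power_card_eq_same[of x] card by simp
  show char: "CHAR('a) = 2"
    using card \<open>h > 0\<close> by (intro CHAR_eq_2_of_CARD[of "2 * h"]) auto
  show "(x + y) ^ 2 ^ k = x ^ 2 ^ k + y ^ 2 ^ k" "(x + y) ^ 2 ^ h = x ^ 2 ^ h + y ^ 2 ^ h" for x y :: 'a
    by (intro freshmans_dream'; simp add: char)+
  show "(x ^ 2 ^ h) ^ 2 ^ h = x" for x :: 'a
    using card'[of x] by (simp add: power_add mult_2 flip: power_mult)
  show "x = 0 \<or> x = 1" if x: "x ^ 2 ^ k = x" for x :: 'a
  proof -
    \<comment> \<open>By Bezout, the \<open>i\<close>-th iterate of \<open>f\<close> is squaring on
      this field, so a fixed point of \<open>f\<close> satisfies \<open>x = x ^ 2\<close>.\<close>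
    obtain i j where ij: "k * i = 2 * h * j + 1"
      using coprime_bezout_strong[OF k] \<open>h > 0\<close> by auto
    have "x = x ^ 2 ^ (k * i)"
      using power_two_power_mult_fixed[OF x] by simp
    also have "\<dots> = (x ^ 2 ^ (2 * h * j)) ^ 2"
      by (simp only: ij power_add power_mult power_one_right)
    also have "\<dots> = x ^ 2"
      using power_two_power_mult_fixed[OF card'] by simp
    finally show ?thesis by (simp add: power2_eq_square)
  qed
  show "is_cube x" if x: "x ^ 2 ^ h = x" for x :: 'a
  proof (rule is_cube_square)
    obtain j where j: "2 ^ h + 1 = 3 * (j :: nat)"
      using three_dvd_two_power_Suc[OF h] by (elim dvdE)
    have "x ^ 2 = x ^ (2 ^ h + 1)" using x by (simp add: power2_eq_square)
    also have "\<dots> = (x ^ j) ^ 3" by (simp only: j power_mult mult.commute[of 3])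
    finally show "is_cube (x ^ 2)" by simp
  qed
  have *: "is_cube (x * x ^ 2 ^ i)" if i: "odd i" for i and x :: 'a
  proof -
    obtain j where j: "2 ^ i + 1 = 3 * (j :: nat)"
      using three_dvd_two_power_Suc[OF i] by (elim dvdE)
    have "x * x ^ 2 ^ i = x ^ (2 ^ i + 1)" by simp
    also have "\<dots> = (x ^ j) ^ 3" by (simp only: j power_mult mult.commute[of 3])
    finally show ?thesis by simp
  qed
  show "is_cube (x * x ^ 2 ^ k)" and "is_cube (x * x ^ 2 ^ h)" for x :: 'a
    using * h \<open>odd k\<close> by auto
  show "(x ^ 2 ^ h) ^ 2 ^ k = (x ^ 2 ^ k) ^ 2 ^ h" for x :: 'a
    by (simp only: mult.commute flip: power_mult)
qed (simp_all add: power_mult_distrib)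

text \<open>Cubing misses \<open>B\<close>, so on a finite field it is not injective; two elements
  with the same cube have the required quotient.\<close>

lemma exists_cube_root_of_unity:
  fixes B :: "'a::finite_field"
  assumes "\<not> is_cube B"
  shows "\<exists>w::'a. w ^ 3 = 1 \<and> w \<noteq> 1"
proof -
  have "\<not> surj (\<lambda>x::'a. x ^ 3)"
    using assms unfolding surj_def is_cube_def by blast
  then have "\<not> inj (\<lambda>x::'a. x ^ 3)"
    using finite_UNIV_inj_surj[OF finite_class.finite_UNIV] by blast
  then obtain x y :: 'a where xy: "x ^ 3 = y ^ 3" "x \<noteq> y"
    unfolding inj_def by blast
  then have "y \<noteq> 0" by auto
  then have "(x / y) ^ 3 = 1" and "x / y \<noteq> 1"
    using xy by (auto simp: power_divide)
  then show ?thesis by blast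
qed

section \<open>Walsh transforms of quadratic three-to-one functions\<close>

text \<open>Translation by an \<open>h\<close> with \<open>\<chi> h = - 1\<close> negates the sum.
  \<open>H\<close> is general because the radical of a quadratic form is needed besides the whole
  field.\<close>

lemma sum_sign_character:
  fixes H :: "'a::ab_group_add set" and \<chi> :: "'a \<Rightarrow> int"
  assumes add: "\<And>x y. x \<in> H \<Longrightarrow> y \<in> H \<Longrightarrow> x + y \<in> H"
    and char: "\<And>x. x \<in> H \<Longrightarrow> x + x = 0"
    and mult: "\<And>x y. x \<in> H \<Longrightarrow> y \<in> H \<Longrightarrow> \<chi> (x + y) = \<chi> x * \<chi> y"
    and sign: "\<And>x. x \<in> H \<Longrightarrow> \<chi> x = 1 \<or> \<chi> x = - 1"
  shows "(\<Sum>x\<in>H. \<chi> x) = (if \<forall>x\<in>H. \<chi> x = 1 then int (card H) else 0)"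
proof (cases "\<forall>x\<in>H. \<chi> x = 1")
  case False
  then obtain h where h: "h \<in> H" "\<chi> h = - 1" using sign by blast
  have hh: "h + (h + x) = x" for x
    using char[OF h(1)] by (simp flip: add.assoc)
  have "(\<Sum>x\<in>H. \<chi> x) = (\<Sum>x\<in>H. \<chi> (h + x))"
    by (rule sum.reindex_bij_witness[of _ "\<lambda>x. h + x" "\<lambda>x. h + x"]) (use h add in \<open>auto simp: hh\<close>)
  also have "\<dots> = - (\<Sum>x\<in>H. \<chi> x)"
    using h mult by (simp add: sum_negf)
  finally have "(\<Sum>x\<in>H. \<chi> x) = 0" by simp
  then show ?thesis by (simp only: False if_False)
qed simp

lemma three_to_one_sum:
  fixes G :: "'a::{zero,finite} \<Rightarrow> 'a" and h :: "'a \<Rightarrow> int"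
  assumes "three_to_one G"
  shows "(\<Sum>x\<in>UNIV. h (G x)) = h 0 + 3 * (\<Sum>w\<in>range G - {0}. h w)"
proof -
  have G0: "G z = 0 \<longleftrightarrow> z = 0" for z
    using assms unfolding three_to_one_def by blast
  have fibre: "card {z. G z = w} = 3" if "w \<in> range G" "w \<noteq> 0" for w
    using assms that unfolding three_to_one_def by blast
  have "(\<Sum>x\<in>UNIV. h (G x)) = (\<Sum>w\<in>range G. \<Sum>x | G x = w. h (G x))"
    using sum.image_gen[of UNIV "\<lambda>x. h (G x)" G] by simp
  also have "\<dots> = (\<Sum>w\<in>range G. int (card {x. G x = w}) * h w)"
    by (intro sum.cong) auto
  also have "\<dots> = int (card {x. G x = 0}) * h 0 + (\<Sum>w\<in>range G - {0}. int (card {x. G x = w}) * h w)"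
    using G0[of 0] by (intro sum.remove) (auto intro: rev_image_eqI[of 0])
  also have "(\<Sum>w\<in>range G - {0}. int (card {x. G x = w}) * h w) = (\<Sum>w\<in>range G - {0}. 3 * h w)"
    using fibre by (intro sum.cong) auto
  finally show ?thesis
    by (simp add: G0 sum_distrib_left)
qed

lemma three_to_one_card_collisions:
  fixes G :: "'a::{zero,finite} \<Rightarrow> 'a"
  assumes "three_to_one G"
  shows "(\<Sum>x\<in>UNIV. card {y. G y = G x}) = 3 * CARD('a) - 2"
proof -
  have "(\<Sum>x\<in>UNIV. card {y. G y = G x}) = card {y. G y = G 0} + (\<Sum>x\<in>UNIV - {0}. card {y. G y = G x})"
    by (intro sum.remove) auto
  also have "card {y. G y = G 0} = 1"
  proof -
    have G0: "G z = 0 \<longleftrightarrow> z = 0" for z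
      using assms unfolding three_to_one_def by blast
    then have G_0: "G 0 = 0" by simp
    show ?thesis by (simp add: G0 G_0)
  qed
  also have "(\<Sum>x\<in>UNIV - {0}. card {y. G y = G x}) = (\<Sum>x\<in>UNIV - {0::'a}. 3)"
    using assms unfolding three_to_one_def by (intro sum.cong) auto
  also have "\<dots> = 3 * (CARD('a) - 1)"
    by simp
  finally show ?thesis
    using zero_less_card_finite[where 'a='a] by linarith
qed

section \<open>Walsh sums for a sign character: squares and moments\<close>

locale additive_sign =
  fixes \<chi> :: "'k::finite_field \<Rightarrow> int"
  assumes char_two: "x + x = (0::'k)"
    and sign: "\<chi> x = 1 \<or> \<chi> x = - 1"
    and mult: "\<chi> (x + y) = \<chi> x * \<chi> y"
    and nontrivial: "\<exists>x. \<chi> x \<noteq> 1"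
begin

lemma zero: "\<chi> 0 = 1"
  using mult[of 0 0] sign[of 0] by auto

lemma add_self_left: "x + (x + y) = (y::'k)"
  by (simp add: char_two flip: add.assoc)

lemma add_eq_0_iff_eq: "x + y = 0 \<longleftrightarrow> x = (y::'k)"
  by (metis char_two add_right_cancel)

lemma orthogonality: "(\<Sum>b\<in>UNIV. \<chi> (b * c)) = (if c = 0 then int CARD('k) else 0)"
proof (cases "c = 0")
  case False
  obtain x where "\<chi> x \<noteq> 1" using nontrivial by blast
  then have "\<chi> (x / c * c) \<noteq> 1" using False by simp
  then have "\<not> (\<forall>b\<in>UNIV. \<chi> (b * c) = 1)" by blast
  moreover have "(\<Sum>b\<in>UNIV. \<chi> (b * c)) = (if \<forall>b\<in>UNIV. \<chi> (b * c) = 1 then int CARD('k) else 0)"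
    by (rule sum_sign_character) (auto simp: char_two mult sign distrib_right)
  ultimately show ?thesis using False by simp
qed (simp add: zero)

definition W :: "('k \<Rightarrow> 'k) \<Rightarrow> 'k \<Rightarrow> 'k \<Rightarrow> int" where
  "W G b a = (\<Sum>x\<in>UNIV. \<chi> (b * G x + a * x))"

text \<open>The radical of the symmetric bilinear form attached to the component \<open>b\<close> of
  \<open>G\<close>.\<close>

definition radical :: "('k \<Rightarrow> 'k) \<Rightarrow> 'k \<Rightarrow> 'k set" where
  "radical G b = {d. \<forall>x. \<chi> (b * polar G x d) = 1}"

text \<open>Substituting \<open>y = x + d\<close> in the double sum, the sum over \<open>x\<close>
  kills every \<open>d\<close> outside the radical, and on the radical the remaining summand is a
  character.\<close>

lemma W_square:
  assumes "quadratic G"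
  shows "(W G b a)\<^sup>2 = (if \<forall>d\<in>radical G b. \<chi> (b * G d + a * d) = 1
           then int CARD('k) * int (card (radical G b)) else 0)"
proof -
  have polar_add: "polar G (x + y) z = polar G x z + polar G y z" for x y z
    using assms unfolding quadratic_def additive_def by blast
  have polar_sym: "polar G x y = polar G y x" for x y
    by (simp add: polar_def add.commute)
  have polar_add': "polar G z (x + y) = polar G z x + polar G z y" for x y z
    by (metis polar_add polar_sym)
  have G_add: "G (x + y) = polar G x y + G x + G y" for x y
    by (simp add: polar_def)
  have inner: "(\<Sum>x\<in>UNIV. \<chi> (b * polar G x d)) = (if d \<in> radical G b then int CARD('k) else 0)" for d
    using sum_sign_character[of UNIV "\<lambda>x. \<chi> (b * polar G x d)"]
    by (simp add: radical_def char_two polar_add distrib_left mult sign)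
  have "(W G b a)\<^sup>2 = (\<Sum>x\<in>UNIV. \<Sum>y\<in>UNIV. \<chi> (b * G x + a * x) * \<chi> (b * G y + a * y))"
    by (simp add: W_def power2_eq_square sum_product)
  also have "\<dots> = (\<Sum>x\<in>UNIV. \<Sum>d\<in>UNIV. \<chi> (b * G d + a * d) * \<chi> (b * polar G x d))"
  proof (rule sum.cong[OF refl])
    fix x :: 'k
    have eq: "\<chi> (b * G x + a * x) * \<chi> (b * G (x + d) + a * (x + d)) = \<chi> (b * G d + a * d) * \<chi> (b * polar G x d)" for d
      unfolding mult[symmetric] G_add
      by (rule arg_cong[of _ _ \<chi>]) (simp add: algebra_simps char_two add_self_left)
    show "(\<Sum>y\<in>UNIV. \<chi> (b * G x + a * x) * \<chi> (b * G y + a * y))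
        = (\<Sum>d\<in>UNIV. \<chi> (b * G d + a * d) * \<chi> (b * polar G x d))"
      by (intro sum.reindex_bij_witness[of _ "\<lambda>d. x + d" "\<lambda>y. x + y"]) (simp_all add: add_self_left flip: eq)
  qed
  also have "\<dots> = (\<Sum>d\<in>UNIV. \<chi> (b * G d + a * d) * (\<Sum>x\<in>UNIV. \<chi> (b * polar G x d)))"
    by (subst sum.swap) (simp add: sum_distrib_left)
  also have "\<dots> = (\<Sum>d\<in>UNIV. if d \<in> radical G b then int CARD('k) * \<chi> (b * G d + a * d) else 0)"
    by (intro sum.cong) (auto simp: inner)
  also have "\<dots> = int CARD('k) * (\<Sum>d\<in>radical G b. \<chi> (b * G d + a * d))"
    by (simp add: sum_distrib_left flip: sum.inter_restrict)
  also have "(\<Sum>d\<in>radical G b. \<chi> (b * G d + a * d))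
      = (if \<forall>d\<in>radical G b. \<chi> (b * G d + a * d) = 1 then int (card (radical G b)) else 0)"
  proof (rule sum_sign_character)
    fix x y assume xy: "x \<in> radical G b" "y \<in> radical G b"
    then show "x + y \<in> radical G b"
      by (simp add: radical_def polar_add' distrib_left mult)
    have "\<chi> (b * G (x + y) + a * (x + y)) = \<chi> (b * polar G x y) * (\<chi> (b * G x + a * x) * \<chi> (b * G y + a * y))"
      unfolding mult[symmetric] G_add by (simp add: algebra_simps)
    then show "\<chi> (b * G (x + y) + a * (x + y)) = \<chi> (b * G x + a * x) * \<chi> (b * G y + a * y)"
      using xy by (simp add: radical_def)
  qed (auto simp: char_two sign)
  finally show ?thesis by simp
qed

lemma parseval: "(\<Sum>a\<in>UNIV. (W G b a)\<^sup>2) = (int CARD('k))\<^sup>2"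
proof -
  have "(\<Sum>a\<in>UNIV. (W G b a)\<^sup>2)
      = (\<Sum>a\<in>UNIV. \<Sum>x\<in>UNIV. \<Sum>y\<in>UNIV. \<chi> (b * G x + b * G y) * \<chi> (a * (x + y)))"
    by (simp add: W_def power2_eq_square sum_product mult mult_ac distrib_left)
  also have "\<dots> = (\<Sum>x\<in>UNIV. \<Sum>a\<in>UNIV. \<Sum>y\<in>UNIV. \<chi> (b * G x + b * G y) * \<chi> (a * (x + y)))"
    by (rule sum.swap)
  also have "\<dots> = (\<Sum>x\<in>UNIV. \<Sum>y\<in>UNIV. \<Sum>a\<in>UNIV. \<chi> (b * G x + b * G y) * \<chi> (a * (x + y)))"
    by (intro sum.cong[OF refl] sum.swap)
  also have "\<dots> = (\<Sum>x\<in>UNIV. \<Sum>y\<in>UNIV. if (x::'k) = y then int CARD('k) else 0)"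
  proof -
    have "(\<Sum>a\<in>UNIV. \<chi> (b * G x + b * G y) * \<chi> (a * (x + y))) = (if x = y then int CARD('k) else 0)" for x y
      unfolding sum_distrib_left[symmetric] orthogonality
      by (simp add: add_eq_0_iff_eq char_two zero)
    then show ?thesis by (simp only:)
  qed
  also have "\<dots> = (int CARD('k))\<^sup>2"
    by (simp add: power2_eq_square)
  finally show ?thesis .
qed

lemma sum_W_0: "(\<Sum>b\<in>UNIV. W G b 0) = int CARD('k) * int (card {x. G x = 0})"
proof -
  have "(\<Sum>b\<in>UNIV. W G b 0) = (\<Sum>x\<in>UNIV. \<Sum>b\<in>UNIV. \<chi> (b * G x))"
    unfolding W_def by (subst sum.swap) simp
  also have "\<dots> = (\<Sum>x\<in>UNIV. if G x = 0 then int CARD('k) else 0)"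
    by (simp add: orthogonality)
  also have "\<dots> = int CARD('k) * int (card {x. G x = 0})"
    by (simp add: sum.If_cases)
  finally show ?thesis .
qed

text \<open>Summing over \<open>b\<close> first leaves only the pairs with
  \<open>G x = G y\<close>.\<close>

lemma sum_W_0_square:
  "(\<Sum>b\<in>UNIV. (W G b 0)\<^sup>2) = int CARD('k) * int (\<Sum>x\<in>UNIV. card {y. G y = G x})"
proof -
  have "(\<Sum>b\<in>UNIV. (W G b 0)\<^sup>2) = (\<Sum>b\<in>UNIV. \<Sum>x\<in>UNIV. \<Sum>y\<in>UNIV. \<chi> (b * (G x + G y)))"
    by (simp add: W_def power2_eq_square sum_product mult distrib_left)
  also have "\<dots> = (\<Sum>x\<in>UNIV. \<Sum>b\<in>UNIV. \<Sum>y\<in>UNIV. \<chi> (b * (G x + G y)))"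
    by (rule sum.swap)
  also have "\<dots> = (\<Sum>x\<in>UNIV. \<Sum>y\<in>UNIV. \<Sum>b\<in>UNIV. \<chi> (b * (G x + G y)))"
    by (intro sum.cong[OF refl] sum.swap)
  also have "\<dots> = (\<Sum>x\<in>UNIV. \<Sum>y\<in>UNIV. if G x = G y then int CARD('k) else 0)"
    by (simp only: orthogonality add_eq_0_iff_eq)
  also have "\<dots> = int CARD('k) * int (\<Sum>x\<in>UNIV. card {y. G y = G x})"
    by (simp add: sum.If_cases sum_distrib_left eq_commute mult.commute)
  finally show ?thesis .
qed

end

section \<open>The absolute trace as a sign character\<close>

lemma abs_trace_add:
  assumes "CHAR('k::finite_field) = 2"
  shows "abs_trace n (x + y :: 'k) = abs_trace n x + abs_trace n y"
  unfolding abs_trace_def by (simp add: freshmans_dream'[where 'a='k] assms sum.distrib)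

text \<open>Squaring shifts the summands cyclically, as \<open>x ^ (2 ^ n) = x\<close>; so the trace
  equals its own square.\<close>

lemma abs_trace_cases:
  assumes "CHAR('k::finite_field) = 2" and "CARD('k) = 2 ^ n"
  shows "abs_trace n (x :: 'k) = 0 \<or> abs_trace n x = 1"
proof -
  have "abs_trace n x ^ 2 = (\<Sum>i<n. (x ^ 2 ^ i) ^ 2)"
    unfolding abs_trace_def by (rule freshmans_dream_sum) (simp_all add: assms)
  also have "\<dots> = (\<Sum>i<n. x ^ 2 ^ Suc i)"
    by (simp add: mult.commute flip: power_mult)
  also have "\<dots> + x ^ 2 ^ 0 = (\<Sum>i<Suc n. x ^ 2 ^ i)"
    by (subst sum.lessThan_Suc_shift) (rule add.commute)
  also have "\<dots> = abs_trace n x + x"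
    using finite_field_power_card_eq_same[of x] by (simp add: abs_trace_def assms)
  finally show ?thesis
    by (simp add: power2_eq_square)
qed

text \<open>The trace is a nonzero polynomial of degree at most \<open>2 ^ (n - 1)\<close>, too
  small to vanish on the whole field.\<close>

lemma abs_trace_nontrivial:
  assumes "CARD('k::finite_field) = 2 ^ n" and "0 < n"
  shows "\<exists>x::'k. abs_trace n x \<noteq> 0"
proof (rule ccontr)
  assume *: "\<not> ?thesis"
  define p :: "'k poly" where "p = (\<Sum>i<n. monom 1 (2 ^ i))"
  have "poly p x = abs_trace n x" for x
    by (simp add: p_def abs_trace_def poly_sum poly_monom)
  then have roots: "{x. poly p x = 0} = UNIV"
    using * by auto
  have "coeff p 1 = (\<Sum>i<n. if i = 0 then 1 else 0)"
    unfolding p_def coeff_sum by (intro sum.cong) auto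
  then have "p \<noteq> 0" using \<open>0 < n\<close> by auto
  have "degree p \<le> 2 ^ (n - 1)"
    unfolding p_def by (intro degree_sum_le) (auto simp: degree_monom_eq)
  moreover have "card {x. poly p x = 0} \<le> degree p"
    using \<open>p \<noteq> 0\<close> by (rule card_poly_roots_bound)
  ultimately have "2 ^ n \<le> (2 ^ (n - 1) :: nat)"
    by (metis assms(1) roots le_trans)
  then show False using \<open>0 < n\<close> by simp
qed

lemma additive_sign_abs_trace:
  assumes card: "CARD('k::finite_field) = 2 ^ n" and "0 < n"
  shows "additive_sign (\<lambda>z::'k. sign_F2 (abs_trace n z))"
proof
  have char: "CHAR('k) = 2"
    using assms by (rule CHAR_eq_2_of_CARD)
  then have two: "(1::'k) + 1 = 0"
    using of_nat_CHAR[where 'a='k] by simp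
  show "x + x = 0" for x :: 'k
    by (metis two distrib_left mult.right_neutral mult_zero_right)
  show "sign_F2 (abs_trace n (x + y)) = sign_F2 (abs_trace n x) * sign_F2 (abs_trace n y)" for x y :: 'k
    using abs_trace_cases[OF char card, of x] abs_trace_cases[OF char card, of y] two
    by (auto simp: abs_trace_add[OF char] sign_F2_def)
  show "\<exists>x::'k. sign_F2 (abs_trace n x) \<noteq> 1"
    using abs_trace_nontrivial[OF assms] by (auto simp: sign_F2_def)
qed (auto simp: sign_F2_def)

lemma count_extended_walsh_spectrum:
  "count (extended_walsh_spectrum n G) v = (\<Sum>b\<in>UNIV - {0}. card {a. \<bar>walsh n G b a\<bar> = v})"
proof -
  have "count (extended_walsh_spectrum n G) v
      = card {(b, a). b \<noteq> 0 \<and> \<bar>walsh n G b a\<bar> = v}"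
    unfolding extended_walsh_spectrum_def count_image_mset
    by (simp add: vimage_def Int_def) (rule arg_cong[of _ _ card], auto)
  also have "{(b, a). b \<noteq> 0 \<and> \<bar>walsh n G b a\<bar> = v} = Sigma (UNIV - {0}) (\<lambda>b. {a. \<bar>walsh n G b a\<bar> = v})"
    by auto
  finally show ?thesis by (simp only: card_SigmaI finite_class.finite_UNIV finite_Diff) simp
qed

text \<open>Since \<open>M mod 3 = 1\<close>, the integers \<open>w b\<close> are 1 modulo 3, so \<open>(w b - 1) * (w b + 2) \<ge> 0\<close>;
  the first two moments of \<open>w\<close> make these products sum to 0 over \<open>b \<noteq> 0\<close>.\<close>

lemma classical_walsh_spectrum_of_three_to_one:
  fixes G :: "'k::finite_field \<Rightarrow> 'k"
  assumes card: "CARD('k) = 2 ^ (2 * m)" and m: "even m" "0 < m"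
    and quad: "quadratic G" and three: "three_to_one G"
  shows "classical_walsh_spectrum (2 * m) G"
proof -
  define \<chi> :: "'k \<Rightarrow> int" where "\<chi> = (\<lambda>z. sign_F2 (abs_trace (2 * m) z))"
  interpret additive_sign \<chi>
    unfolding \<chi>_def by (rule additive_sign_abs_trace) (use card m in auto)
  have walsh: "walsh (2 * m) G b a = W G b a" for b a
    unfolding walsh_def W_def by (simp add: \<chi>_def)
  have G0: "G z = 0 \<longleftrightarrow> z = 0" for z
    using three unfolding three_to_one_def by blast
  define M where "M = (2::int) ^ m"
  have M0: "M > 0" by (simp add: M_def)
  have N: "int CARD('k) = M\<^sup>2" by (simp add: card M_def power_mult mult.commute)
  have M3: "M mod 3 = 1"
  proof -
    obtain j where "m = 2 * j" using m by (elim evenE)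
    then have "M = 4 ^ j" by (simp add: M_def power_mult)
    then show ?thesis by (simp add: power_mod[of 4 3, symmetric])
  qed
  \<comment> \<open>\<open>G\<close> hits 0 once and every other value three times, so modulo 3 only
    \<open>\<chi> 0 = 1\<close> remains.\<close>
  have W3: "W G b 0 mod 3 = 1" for b
    unfolding W_def using three_to_one_sum[OF three, of "\<lambda>w. \<chi> (b * w)"] by (simp add: zero)
  define r where "r b = int (card (radical G b))" for b
  have W_sq: "(W G b a)\<^sup>2 = M\<^sup>2 * r b" if "W G b a \<noteq> 0" for b a
    using W_square[OF quad, of b a] that by (auto simp: N r_def split: if_splits)
  have W_nz: "W G b 0 \<noteq> 0" for b
    using W3[of b] by auto
  define w where "w b = W G b 0 div M" for b
  have w: "W G b 0 = M * w b" for b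
  proof -
    \<comment> \<open>Being nonzero, \<open>W G b 0\<close> falls into the first case of
      \<open>W_square\<close>.\<close>
    have "M\<^sup>2 dvd (W G b 0)\<^sup>2" using W_sq[OF W_nz] by simp
    then have "M dvd W G b 0" by simp
    then show ?thesis by (simp add: w_def)
  qed
  have w_sq: "(w b)\<^sup>2 = r b" for b
    using W_sq[OF W_nz, of b] M0 by (simp add: w power_mult_distrib)
  have w3: "w b mod 3 = 1" for b
    using W3[of b] M3 unfolding w by (metis mod_mult_left_eq mult_1)
  have "M * (\<Sum>b\<in>UNIV. w b) = M * M"
    using sum_W_0[of G] by (simp add: w G0 N power2_eq_square sum_distrib_left)
  then have sum_w: "(\<Sum>b\<in>UNIV. w b) = M" using M0 by simp
  have "M\<^sup>2 * (\<Sum>b\<in>UNIV. (w b)\<^sup>2) = M\<^sup>2 * (3 * M\<^sup>2 - 2)"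
  proof -
    have "int (3 * CARD('k) - 2) = 3 * M\<^sup>2 - 2"
      using N zero_less_card_finite[where 'a='k] by linarith
    then show ?thesis
      using sum_W_0_square[of G] unfolding three_to_one_card_collisions[OF three]
      by (simp add: w N power_mult_distrib sum_distrib_left)
  qed
  then have sum_w_sq: "(\<Sum>b\<in>UNIV. (w b)\<^sup>2) = 3 * M\<^sup>2 - 2" using M0 by simp
  have "W G 0 0 = M * M" using N by (simp add: W_def zero power2_eq_square)
  then have w_0: "w 0 = M" using M0 by (simp add: w)
  have split: "(\<Sum>b\<in>UNIV. h b) = h 0 + (\<Sum>b\<in>UNIV - {0}. h b)" for h :: "'k \<Rightarrow> int"
    by (rule sum.remove) auto
  have card_nz: "(\<Sum>b\<in>UNIV - {0::'k}. 1) = M\<^sup>2 - 1"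
    using split[of "\<lambda>_. 1"] N by simp
  have "(\<Sum>b\<in>UNIV - {0}. (w b - 1) * (w b + 2)) = (\<Sum>b\<in>UNIV - {0}. (w b)\<^sup>2 + w b - 2 * 1)"
    by (simp add: algebra_simps power2_eq_square)
  \<comment> \<open>Without \<open>w 0 = M\<close> the moments are 0 and
    \<open>2 * M\<^sup>2 - 2\<close>, and there are \<open>M\<^sup>2 - 1\<close> values of
    \<open>b\<close>.\<close>
  also have "\<dots> = 0"
    using sum_w sum_w_sq split[of w] split[of "\<lambda>b. (w b)\<^sup>2"]
    unfolding sum.distrib sum_subtractf sum_distrib_left[symmetric] card_nz w_0 by simp
  finally have "(\<Sum>b\<in>UNIV - {0}. (w b - 1) * (w b + 2)) = 0" .
  moreover have "(w b - 1) * (w b + 2) \<ge> 0" for b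
  proof -
    \<comment> \<open>The residue 1 modulo 3 excludes 0 and -1.\<close>
    have "w b \<ge> 1 \<or> w b \<le> - 2" using w3[of b] by presburger
    then show ?thesis by (auto intro: mult_nonneg_nonneg mult_nonpos_nonpos)
  qed
  ultimately have "(w b - 1) * (w b + 2) = 0" if "b \<noteq> 0" for b
    using that sum_nonneg_eq_0_iff[of "UNIV - {0}" "\<lambda>b. (w b - 1) * (w b + 2)"] by simp
  then have w_cases: "w b = 1 \<or> w b = - 2" if "b \<noteq> 0" for b
    using that by fastforce

  define S where "S v = {b. b \<noteq> 0 \<and> w b = v}" for v
  have sum_S: "(\<Sum>b\<in>UNIV - {0}. h (w b)) = int (card (S 1)) * h 1 + int (card (S (- 2))) * h (- 2)" for h :: "int \<Rightarrow> int"
  proof -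
    have "UNIV - {0} = S 1 \<union> S (- 2)" using w_cases by (auto simp: S_def)
    also have "(\<Sum>b\<in>\<dots>. h (w b)) = (\<Sum>b\<in>S 1. h (w b)) + (\<Sum>b\<in>S (- 2). h (w b))"
      by (rule sum.union_disjoint) (auto simp: S_def)
    also have "(\<Sum>b\<in>S 1. h (w b)) = int (card (S 1)) * h 1"
      by (simp add: S_def)
    also have "(\<Sum>b\<in>S (- 2). h (w b)) = int (card (S (- 2))) * h (- 2)"
      by (simp add: S_def)
    finally show ?thesis .
  qed
  have S1: "int (card (S 1)) = 2 * int (card (S (- 2)))"
    using sum_S[of "\<lambda>v. v"] split[of w] sum_w w_0 by simp
  have S2: "3 * int (card (S (- 2))) = M\<^sup>2 - 1"
    using sum_S[of "\<lambda>v. 1"] card_nz S1 by simp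

  define A where "A b = card {a. W G b a \<noteq> 0}" for b
  \<comment> \<open>By Parseval: for fixed \<open>b\<close> all nonzero squares equal
    \<open>M\<^sup>2 * r b\<close>.\<close>
  have rA: "r b * int (A b) = M\<^sup>2" for b
  proof -
    have "(\<Sum>a\<in>UNIV. (W G b a)\<^sup>2) = (\<Sum>a\<in>UNIV. if W G b a \<noteq> 0 then M\<^sup>2 * r b else 0)"
      using W_sq by (intro sum.cong) auto
    then have "M\<^sup>2 * (r b * int (A b)) = M\<^sup>2 * M\<^sup>2"
      using parseval[of G b] by (simp add: sum.If_cases A_def N power2_eq_square mult_ac)
    moreover have "M\<^sup>2 \<noteq> 0" using M0 by simp
    ultimately show ?thesis by (metis mult_left_cancel)
  qed
  have abs_W: "\<bar>W G b a\<bar> = M * \<bar>w b\<bar>" if "W G b a \<noteq> 0" for b a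
  proof -
    have "(W G b a)\<^sup>2 = (M * w b)\<^sup>2" using W_sq[OF that] by (simp add: w_sq power_mult_distrib)
    then show ?thesis using M0 by (simp add: power2_eq_iff abs_mult) (auto simp: abs_mult)
  qed
  have count_pos: "int (card {a. \<bar>W G b a\<bar> = v}) = (if v = M * \<bar>w b\<bar> then int (A b) else 0)" if "v > 0" for b v
  proof -
    have "{a. \<bar>W G b a\<bar> = v} = (if v = M * \<bar>w b\<bar> then {a. W G b a \<noteq> 0} else {})"
      using abs_W that by auto
    then show ?thesis by (simp add: A_def)
  qed
  have count_0: "int (card {a. W G b a = 0}) = M\<^sup>2 - int (A b)" for b
  proof -
    have "CARD('k) = card ({a. W G b a = 0} \<union> {a. W G b a \<noteq> 0})"
      by (rule arg_cong[of _ _ card]) auto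
    also have "\<dots> = card {a. W G b a = 0} + A b"
      unfolding A_def by (rule card_Un_disjoint) auto
    finally show ?thesis using N by simp
  qed
  have A_w: "(w b)\<^sup>2 * int (A b) = M\<^sup>2" for b
    using rA by (simp add: w_sq)
  have m_split: "2 * m = 2 * m - 2 + 2" using m by simp
  \<comment> \<open>A quarter of the field order, so that \<open>A b\<close>, which is
    \<open>M\<^sup>2\<close> or \<open>M\<^sup>2\<close> over 4, becomes \<open>4 * Q\<close> or
    \<open>Q\<close>.\<close>
  define Q where "Q = (2::int) ^ (2 * m - 2)"
  have MQ: "M\<^sup>2 = 4 * Q"
  proof -
    have "M\<^sup>2 = 2 ^ (2 * m)" by (simp add: M_def mult.commute flip: power_mult)
    also have "\<dots> = 2 ^ (2 * m - 2 + 2)" by (rule arg_cong[OF m_split])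
    finally show ?thesis by (simp only: power_add Q_def) simp
  qed
  define c where "c v = int (count (extended_walsh_spectrum (2 * m) G) v)" for v
  have c: "c v = (\<Sum>b\<in>UNIV - {0}. int (card {a. \<bar>W G b a\<bar> = v}))" for v
    by (simp add: c_def count_extended_walsh_spectrum walsh)
  have A1: "int (A b) = (if w b = 1 then 4 * Q else Q)" if "b \<noteq> 0" for b
    using A_w[of b] w_cases[OF that] MQ by auto
  have abs_w: "\<bar>w b\<bar> = (if w b = 1 then 1 else 2)" if "b \<noteq> 0" for b
    using w_cases[OF that] by auto
  have "c 0 = (\<Sum>b\<in>UNIV - {0}. if w b = 1 then 0 else 3 * Q)"
    unfolding c by (intro sum.cong) (auto simp: count_0 A1 MQ)
  also have "\<dots> = (4 * Q - 1) * Q"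
    using sum_S[of "\<lambda>v. if v = 1 then 0 else 3 * Q"] S2 MQ by (simp add: algebra_simps)
  finally have c0: "c 0 = (4 * Q - 1) * Q" .
  have "c M = (\<Sum>b\<in>UNIV - {0}. if w b = 1 then 4 * Q else 0)"
    unfolding c using M0 by (intro sum.cong) (auto simp: count_pos A1 abs_w)
  also have "3 * \<dots> = (4 * Q - 1) * (8 * Q)"
    using sum_S[of "\<lambda>v. if v = 1 then 4 * Q else 0"] S1 S2 MQ by simp
  finally have c1: "3 * c M = (4 * Q - 1) * (8 * Q)" .
  have "c (2 * M) = (\<Sum>b\<in>UNIV - {0}. if w b = 1 then 0 else Q)"
    unfolding c using M0 by (intro sum.cong) (auto simp: count_pos A1 abs_w)
  also have "3 * \<dots> = (4 * Q - 1) * Q"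
    using sum_S[of "\<lambda>v. if v = 1 then 0 else Q"] S2 MQ by simp
  finally have c2: "3 * c (2 * M) = (4 * Q - 1) * Q" .
  have real_c: "real (count (extended_walsh_spectrum (2 * m) G) v) = real_of_int (c v)" for v
    by (simp add: c_def)
  have pow: "(2::real) ^ (2 * m - 2) = Q" "(2::real) ^ (2 * m) = 4 * Q" "(2::real) ^ (2 * m + 1) = 8 * Q"
  proof -
    show Q: "(2::real) ^ (2 * m - 2) = Q" by (simp add: Q_def)
    have "(2::real) ^ (2 * m) = 2 ^ (2 * m - 2 + 2)" by (rule arg_cong[OF m_split])
    then show "(2::real) ^ (2 * m) = 4 * Q" by (simp only: power_add Q) simp
    then show "(2::real) ^ (2 * m + 1) = 8 * Q" by simp
  qed
  have exps: "(2::int) ^ (2 * m div 2) = M" "(2::int) ^ ((2 * m + 2) div 2) = 2 * M"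
    by (simp_all add: M_def)
  have "real_of_int (c 0) = (4 * Q - 1) * Q" "3 * real_of_int (c M) = (4 * Q - 1) * (8 * Q)"
    "3 * real_of_int (c (2 * M)) = (4 * Q - 1) * Q"
    using c0 arg_cong[OF c1, of real_of_int] arg_cong[OF c2, of real_of_int] by simp_all
  then show ?thesis
    unfolding classical_walsh_spectrum_def exps real_c pow by simp
qed

section \<open>Transport along an additive identification\<close>

lemma three_to_one_conjugate:
  fixes F :: "'b::zero \<Rightarrow> 'b" and \<phi> :: "'a::zero \<Rightarrow> 'b"
  assumes F: "three_to_one F" and "bij \<phi>" and \<phi>0: "\<phi> 0 = 0"
  shows "three_to_one (inv \<phi> \<circ> F \<circ> \<phi>)"
proof -
  have inv: "inv \<phi> u = z \<longleftrightarrow> u = \<phi> z" for u z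
    using \<open>bij \<phi>\<close> by (metis bij_inv_eq_iff)
  have \<phi>_0_iff: "\<phi> z = 0 \<longleftrightarrow> z = 0" for z
    using \<open>bij \<phi>\<close> \<phi>0 by (metis bij_is_inj injD)
  have "card {z. F (\<phi> z) = \<phi> w} = card {u. F u = \<phi> w}" for w
  proof -
    have "{u. F u = \<phi> w} = \<phi> ` {z. F (\<phi> z) = \<phi> w}"
      using bij_is_surj[OF \<open>bij \<phi>\<close>] by (force simp: surj_def)
    then show ?thesis
      using bij_is_inj[OF \<open>bij \<phi>\<close>] by (simp add: card_image inj_on_subset)
  qed
  moreover have "card {u. F u = \<phi> w} = 3" if "\<phi> w \<in> range F" "w \<noteq> 0" for w
    using F that \<phi>_0_iff unfolding three_to_one_def by blast
  ultimately have "card {z. F (\<phi> z) = \<phi> w} = 3" if "\<phi> w \<in> range F" "w \<noteq> 0" for w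
    using that by simp
  moreover have "\<phi> w \<in> range F" if w: "w \<in> range (inv \<phi> \<circ> F \<circ> \<phi>)" for w
  proof -
    obtain z where "w = (inv \<phi> \<circ> F \<circ> \<phi>) z" using w by (rule rangeE)
    then have "F (\<phi> z) = \<phi> w" using inv[of "F (\<phi> z)" w] by simp
    from this[symmetric] show ?thesis by simp
  qed
  moreover have "F z = 0 \<longleftrightarrow> z = 0" for z
    using F unfolding three_to_one_def by blast
  ultimately show ?thesis
    unfolding three_to_one_def by (simp add: inv \<phi>0 \<phi>_0_iff)
qed

lemma quadratic_conjugate:
  fixes F :: "'b::ab_group_add \<Rightarrow> 'b" and \<phi> :: "'a::ab_group_add \<Rightarrow> 'b"
  assumes F: "quadratic F" and "bij \<phi>" and "additive \<phi>"
  shows "quadratic (inv \<phi> \<circ> F \<circ> \<phi>)"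
proof -
  interpret additive \<phi> by fact
  have inv_add: "inv \<phi> (u + v) = inv \<phi> u + inv \<phi> v" for u v
    using \<open>bij \<phi>\<close> by (metis add bij_inv_eq_iff)
  then interpret inv: additive "inv \<phi>" by unfold_locales
  have "polar (inv \<phi> \<circ> F \<circ> \<phi>) x y = inv \<phi> (polar F (\<phi> x) (\<phi> y))" for x y
    by (simp add: polar_def add inv.diff)
  then show ?thesis
    using F unfolding quadratic_def additive_def by (simp add: add inv_add)
qed

section \<open>The family \<open>F4\<close>\<close>

theorem theoremC3:
  fixes m n k q r :: nat
    and a B :: "'m::finite_field"
    and F :: "'m \<times> 'm \<Rightarrow> 'm \<times> 'm"
  assumes "m mod 4 = 2"
    and "n = 2 * m"
    and "CARD('m) = 2 ^ m"
    and "CARD('k::finite_field) = 2 ^ n"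
    and "0 < k" and "k < m" and "coprime k m"
    and "q = 2 ^ k"
    and "r = 2 ^ (k + m div 2)"
    and "a \<in> subfield_GF2 (m div 2)" and "a \<noteq> 0"
    and "B \<noteq> 0" and "\<nexists>c. B = c ^ 3"
    and "B ^ (q + r) \<noteq> a ^ (q + 1)"
    and "F = F4 q r a B"
  shows "APN F \<and> three_to_one F \<and>
    (\<forall>\<phi> :: 'k \<Rightarrow> 'm \<times> 'm. F2_identification \<phi> \<longrightarrow>
       classical_walsh_spectrum n (inv \<phi> \<circ> F \<circ> \<phi>))"
proof -
  define h where "h = m div 2"
  have m: "m = 2 * h" and h: "odd h"
    using \<open>m mod 4 = 2\<close> unfolding h_def by presburger+
  have k: "odd k" using \<open>coprime k m\<close> m by auto
  interpret frobenius_pair "\<lambda>x::'m. x ^ (2 ^ k)" "\<lambda>x. x ^ (2 ^ h)"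
    by (rule frobenius_pair_power) (use assms(3,7) m h in simp_all)
  have r: "x ^ r = (x ^ 2 ^ h) ^ 2 ^ k" for x :: 'm
    using assms(9) by (simp add: power_add mult.commute flip: h_def power_mult)
  have F: "F = biprojective B (a / B)"
    unfolding \<open>F = _\<close> F4_def biprojective_def r by (simp add: \<open>q = _\<close>)
  have B: "\<not> is_cube B"
    using assms by (simp add: is_cube_def)
  have a: "a ^ 2 ^ h = a"
    using assms by (simp add: subfield_GF2_def h_def)
  \<comment> \<open>Here \<open>B ^ (q + r)\<close> is the image of \<open>B * B ^ (2 ^ h)\<close>,
    the norm of \<open>B\<close> to the subfield, under \<open>x \<mapsto> x ^ q\<close>.\<close>
  have norm: "(B * B ^ 2 ^ h) ^ 2 ^ k \<noteq> a ^ 2 ^ k * a"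
    using assms(14) unfolding power_add r by (simp add: \<open>q = _\<close> power_mult_distrib)
  have quadratic: "quadratic F"
    unfolding F by (rule quadratic_biprojective)
  have APN: "APN F"
    unfolding F using B a \<open>a \<noteq> 0\<close> norm by (rule APN_biprojective)
  obtain w :: 'm where w: "w ^ 3 = 1" "w \<noteq> 1"
    using exists_cube_root_of_unity[OF B] by blast
  have w_odd: "w ^ 2 ^ i = w ^ 2" if i: "odd i" for i
  proof -
    obtain j where j: "2 ^ i + 1 = 3 * (j :: nat)"
      using three_dvd_two_power_Suc[OF i] by (elim dvdE)
    \<comment> \<open>Both sides of the claim, multiplied by \<open>w\<close>, are powers of
      \<open>w ^ 3 = 1\<close>.\<close>
    have "w ^ 2 ^ i * w = (w ^ 3) ^ j"
      unfolding power_mult[symmetric] j[symmetric] by (simp add: mult.commute)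
    also have "\<dots> = w ^ 2 * w"
      using w by (simp add: power2_eq_square power3_eq_cube)
    finally show ?thesis using w by auto
  qed
  have three: "three_to_one F"
    unfolding F using B a \<open>a \<noteq> 0\<close> norm w w_odd[OF k] w_odd[OF h] by (rule three_to_one_biprojective)
  have "classical_walsh_spectrum n (inv \<phi> \<circ> F \<circ> \<phi>)" if "F2_identification \<phi>" for \<phi> :: "'k \<Rightarrow> 'm \<times> 'm"
    unfolding \<open>n = 2 * m\<close>
  proof (rule classical_walsh_spectrum_of_three_to_one)
    have \<phi>: "bij \<phi>" "additive \<phi>" using that by (simp_all add: F2_identification_def)
    then show "quadratic (inv \<phi> \<circ> F \<circ> \<phi>)"
      using quadratic by (intro quadratic_conjugate)
    show "three_to_one (inv \<phi> \<circ> F \<circ> \<phi>)"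
      using three \<phi> by (intro three_to_one_conjugate) (auto simp: additive.zero)
    show "even m" and "0 < m" using m h by (auto intro: Nat.gr0I)
    show "CARD('k) = 2 ^ (2 * m)" using assms by simp
  qed
  with APN three show ?thesis by blast
qed

end
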